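(* Let $H_0,H_1,H_2$ be Hilbert spaces and let $A_0\colon \operatorname{dom}(A_0)\subseteq H_0\to H_1$ and $A_1\colon \operatorname{dom}(A_1)\subseteq H_1\to H_2$ be densely defined closed linear operators such that $(A_0,A_1)$ is a compact sequence. Let $(u_n)_n$ be a weakly convergent sequence in $\operatorname{dom}(A_0^* )$ and let $(v_n)_n$ be a weakly convergent sequence in $\operatorname{dom}(A_1)$. Then $$\lim_{n\to\infty}\langle u_n,v_n\rangle_{H_1}=\Big\langle \lim_{n\to\infty}u_n,\lim_{n\to\infty}v_n\Big\rangle_{H_1},$$ where the limits on the right-hand side are the weak limits.
   Context: For densely defined closed linear operators $A_0\colon \operatorname{dom}(A_0)\subseteq H_0\to H_1$ and $A_1\colon \operatorname{dom}(A_1)\subseteq H_1\to H_2$ between Hilbert spaces, the pair $(A_0,A_1)$ is called a sequence if $\operatorname{ran}(A_0)\subseteq\ker(A_1)$. A sequence $(A_0,A_1)$ is called compact if the embedding $\operatorname{dom}(A_1)\cap\operatorname{dom}(A_0^* )\hookrightarrow H_1$ is compact, where the intersection carries the norm $(\|u\|^2+\|A_1u\|^2+\|A_0^*u\|^2)^{1/2}$. $A^*$ denotes the Hilbert space adjoint. Domains of closed operators are regarded as Hilbert spaces with the graph inner product, and weak convergence in $\operatorname{dom}(A_0^* )$ and in $\operatorname{dom}(A_1)$ is meant in this sense. *)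

theory Defs
  imports "HOL-Analysis.Analysis"
begin

text \<open>
  The scalar field of the Hilbert spaces is either \<open>real\<close> or \<open>complex\<close>.  Both are treated at once
  by the following class.  It has no further models: \<open>x * rc_cnj x\<close> is real for every \<open>x\<close>, hence
  so is \<open>x + rc_cnj x\<close> (consider \<open>x + 1\<close>), so every \<open>x\<close> is a root of a real quadratic.
\<close>

class real_or_complex = real_normed_field +
  fixes rc_cnj :: "'a \<Rightarrow> 'a"
  assumes rc_cnj_add: "rc_cnj (x + y) = rc_cnj x + rc_cnj y"
    and rc_cnj_mult: "rc_cnj (x * y) = rc_cnj x * rc_cnj y"
    and mult_rc_cnj: "x * rc_cnj x = (norm x)\<^sup>2 *\<^sub>R 1"

instantiation real :: real_or_complex
begin
definition rc_cnj_real :: "real \<Rightarrow> real" where "rc_cnj_real x = x"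
instance by standard (auto simp: rc_cnj_real_def power2_eq_square)
end

instantiation complex :: real_or_complex
begin
definition rc_cnj_complex :: "complex \<Rightarrow> complex" where "rc_cnj_complex = cnj"
instance
proof
  fix x y :: complex
  show "x * rc_cnj x = (norm x)\<^sup>2 *\<^sub>R 1"
    using complex_norm_square[of x] by (simp only: rc_cnj_complex_def scaleR_conv_of_real mult_1_right)
qed (auto simp: rc_cnj_complex_def)
end

text \<open>
  A Hilbert space over \<open>'k\<close>: the class \<open>banach\<close> supplies the norm, its topology and completeness;
  the scalar multiplication and the inner product (linear in the first argument) are explicit
  since they involve two types.
\<close>

locale hilbert_space = vector_space scale
  for scale :: "'k::real_or_complex \<Rightarrow> 'a::banach \<Rightarrow> 'a" +
  fixes ip :: "'a \<Rightarrow> 'a \<Rightarrow> 'k"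
  assumes scale_of_real: "scale (of_real r) x = r *\<^sub>R x"
    and ip_add: "ip (x + y) z = ip x z + ip y z"
    and ip_scale: "ip (scale c x) y = c * ip x y"
    and ip_commute: "ip y x = rc_cnj (ip x y)"
    and ip_self: "ip x x = of_real ((norm x)\<^sup>2)"

lemma hilbert_space_real_inner:
  "hilbert_space scaleR (inner :: 'a::{real_inner,banach} \<Rightarrow> 'a \<Rightarrow> real)"
  by unfold_locales
    (simp_all add: rc_cnj_real_def inner_commute inner_add_right scaleR_add_left scaleR_add_right
      dot_square_norm)

lemma hilbert_space_complex:
  "hilbert_space (*) (\<lambda>x y :: complex. x * cnj y)"
proof unfold_locales
  fix x :: complex
  show "x * cnj x = of_real ((norm x)\<^sup>2)"
    by (rule complex_norm_square[symmetric])
qed (simp_all add: rc_cnj_complex_def scaleR_conv_of_real ring_distribs)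

text \<open>
  An operator \<open>A: dom(A) \<subseteq> H \<rightarrow> K\<close> is a partial map, so that \<open>dom\<close>, \<open>ran\<close> and \<open>Map.graph\<close> are
  those of the library.
\<close>

definition linear_operator ::
  "('k::real_or_complex \<Rightarrow> 'a::banach \<Rightarrow> 'a) \<Rightarrow> ('k \<Rightarrow> 'b::banach \<Rightarrow> 'b) \<Rightarrow> ('a \<rightharpoonup> 'b) \<Rightarrow> bool"
  where
  "linear_operator s s' A \<longleftrightarrow>
     module.subspace s (dom A) \<and>
     (\<forall>x\<in>dom A. \<forall>y\<in>dom A. the (A (x + y)) = the (A x) + the (A y)) \<and>
     (\<forall>c. \<forall>x\<in>dom A. the (A (s c x)) = s' c (the (A x)))"

definition closed_operator :: "('a::banach \<rightharpoonup> 'b::banach) \<Rightarrow> bool" where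
  "closed_operator A \<longleftrightarrow> closed (Map.graph A)"

definition densely_defined :: "('a::banach \<rightharpoonup> 'b::banach) \<Rightarrow> bool" where
  "densely_defined A \<longleftrightarrow> closure (dom A) = UNIV"

definition ker :: "('a \<rightharpoonup> 'b::zero) \<Rightarrow> 'a set" where
  "ker A = {x. A x = Some 0}"

text \<open>The \<open>THE\<close> is meaningful for densely defined \<open>A\<close>, where \<open>z\<close> is unique.\<close>

definition adjoint_op ::
  "('a \<Rightarrow> 'a \<Rightarrow> 'k) \<Rightarrow> ('b \<Rightarrow> 'b \<Rightarrow> 'k) \<Rightarrow> ('a \<rightharpoonup> 'b) \<Rightarrow> ('b \<rightharpoonup> 'a)"
  where
  "adjoint_op ip ip' A = (\<lambda>y.
     if \<exists>z. \<forall>x\<in>dom A. ip' (the (A x)) y = ip x z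
     then Some (THE z. \<forall>x\<in>dom A. ip' (the (A x)) y = ip x z)
     else None)"

definition graph_ip ::
  "('a \<Rightarrow> 'a \<Rightarrow> 'k::plus) \<Rightarrow> ('b \<Rightarrow> 'b \<Rightarrow> 'k) \<Rightarrow> ('a \<rightharpoonup> 'b) \<Rightarrow> 'a \<Rightarrow> 'a \<Rightarrow> 'k"
  where
  "graph_ip ip ip' A x y = ip x y + ip' (the (A x)) (the (A y))"

text \<open>
  Continuous linear functionals on, and weak convergence in, a subspace \<open>D\<close> carrying its own inner
  product \<open>g\<close> with norm \<open>sqrt (g x x)\<close>; the scalar \<open>g x x\<close> is a nonnegative real, so
  \<open>norm (g x x)\<close> is just \<open>g x x\<close> as an element of \<open>real\<close>.
\<close>

definition bounded_functional_on ::
  "('k::real_or_complex \<Rightarrow> 'a::ab_group_add \<Rightarrow> 'a) \<Rightarrow> 'a set \<Rightarrow> ('a \<Rightarrow> 'a \<Rightarrow> 'k) \<Rightarrow> ('a \<Rightarrow> 'k) \<Rightarrow> bool"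
  where
  "bounded_functional_on s D g f \<longleftrightarrow>
     (\<forall>x\<in>D. \<forall>y\<in>D. f (x + y) = f x + f y) \<and>
     (\<forall>c. \<forall>x\<in>D. f (s c x) = c * f x) \<and>
     (\<exists>C. \<forall>x\<in>D. norm (f x) \<le> C * sqrt (norm (g x x)))"

definition weakly_converges_on ::
  "('k::real_or_complex \<Rightarrow> 'a::ab_group_add \<Rightarrow> 'a) \<Rightarrow> 'a set \<Rightarrow> ('a \<Rightarrow> 'a \<Rightarrow> 'k) \<Rightarrow>
   (nat \<Rightarrow> 'a) \<Rightarrow> 'a \<Rightarrow> bool"
  where
  "weakly_converges_on s D g u l \<longleftrightarrow>
     (\<forall>n. u n \<in> D) \<and> l \<in> D \<and>
     (\<forall>f. bounded_functional_on s D g f \<longrightarrow> (\<lambda>n. f (u n)) \<longlonglongrightarrow> f l)"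

definition weakly_converges_in_dom ::
  "('k::real_or_complex \<Rightarrow> 'a::ab_group_add \<Rightarrow> 'a) \<Rightarrow> ('a \<Rightarrow> 'a \<Rightarrow> 'k) \<Rightarrow> ('b \<Rightarrow> 'b \<Rightarrow> 'k) \<Rightarrow>
   ('a \<rightharpoonup> 'b) \<Rightarrow> (nat \<Rightarrow> 'a) \<Rightarrow> 'a \<Rightarrow> bool"
  where
  "weakly_converges_in_dom s ip ip' A u l \<longleftrightarrow>
     weakly_converges_on s (dom A) (graph_ip ip ip' A) u l"

definition operator_sequence :: "('a \<rightharpoonup> 'b) \<Rightarrow> ('b \<rightharpoonup> 'c::zero) \<Rightarrow> bool" where
  "operator_sequence A0 A1 \<longleftrightarrow> ran A0 \<subseteq> ker A1"

text \<open>
  Compactness of the embedding: sets bounded in the norm of \<open>dom(A1) \<inter> dom(A0*)\<close> are relatively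
  compact in \<open>H1\<close>.
\<close>

definition compact_sequence ::
  "('a::banach \<Rightarrow> 'a \<Rightarrow> 'k) \<Rightarrow> ('b::banach \<Rightarrow> 'b \<Rightarrow> 'k) \<Rightarrow>
   ('a \<rightharpoonup> 'b) \<Rightarrow> ('b \<rightharpoonup> 'c::banach) \<Rightarrow> bool"
  where
  "compact_sequence ip0 ip1 A0 A1 \<longleftrightarrow>
     operator_sequence A0 A1 \<and>
     (\<forall>S \<subseteq> dom A1 \<inter> dom (adjoint_op ip0 ip1 A0).
        (\<exists>C. \<forall>u\<in>S. sqrt ((norm u)\<^sup>2 + (norm (the (A1 u)))\<^sup>2
                        + (norm (the (adjoint_op ip0 ip1 A0 u)))\<^sup>2) \<le> C)
        \<longrightarrow> compact (closure S))"

end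

theory Submission
  imports Defs
begin

text \<open>
  Let \<open>P\<close> be the orthogonal projection of \<open>H\<^sub>1\<close> onto the closed subspace \<open>ker A\<^sub>1\<close>. As
  \<open>ran A\<^sub>0 \<subseteq> ker A\<^sub>1\<close>, the operator \<open>A\<^sub>0*\<close> vanishes on \<open>(ker A\<^sub>1)\<^sup>\<bottom>\<close>. Hence \<open>P u\<^sub>n\<close> and
  \<open>(1 - P) v\<^sub>n\<close> both lie in \<open>dom A\<^sub>1 \<inter> dom A\<^sub>0*\<close> and are bounded in its norm, because weakly
  convergent sequences are bounded. Compactness turns their weak convergence into strong
  convergence, and \<open>\<langle>u\<^sub>n, v\<^sub>n\<rangle> = \<langle>P u\<^sub>n, v\<^sub>n\<rangle> + \<langle>u\<^sub>n, (1 - P) v\<^sub>n\<rangle>\<close> is a sum of products of a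
  strongly and a weakly convergent factor.
\<close>

section \<open>Conjugation on the scalar field\<close>

lemma rc_cnj_0 [simp]: "rc_cnj (0::'k::real_or_complex) = 0"
  using rc_cnj_add[of "0::'k" 0] by simp

lemma rc_cnj_minus: "rc_cnj (- x :: 'k::real_or_complex) = - rc_cnj x"
  using rc_cnj_add[of x "- x"] by (simp add: eq_neg_iff_add_eq_0 add.commute)

text \<open>The class only prescribes \<open>x * rc_cnj x\<close>. The value on reals, isometry and
  involutivity therefore all come from cancelling a nonzero factor in
  \<open>mult_rc_cnj\<close>.\<close>

lemma rc_cnj_of_real [simp]: "rc_cnj (of_real r :: 'k::real_or_complex) = of_real r"
proof (cases "r = 0")
  case False
  have "of_real r * rc_cnj (of_real r :: 'k) = of_real r * of_real r"
    by (simp add: mult_rc_cnj scaleR_conv_of_real power2_eq_square)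
  with False show ?thesis by simp
qed simp

lemma norm_rc_cnj [simp]: "norm (rc_cnj x) = norm (x::'k::real_or_complex)"
proof (cases "x = 0")
  case False
  have "norm x * norm (rc_cnj x) = norm x * norm x"
    by (simp flip: norm_mult add: mult_rc_cnj power2_eq_square)
  with False show ?thesis by simp
qed simp

lemma rc_cnj_rc_cnj [simp]: "rc_cnj (rc_cnj x) = (x::'k::real_or_complex)"
proof (cases "x = 0")
  case False
  have "rc_cnj x * rc_cnj (rc_cnj x) = rc_cnj x * x"
    using mult_rc_cnj[of "rc_cnj x"] mult_rc_cnj[of x] by (simp add: mult.commute)
  moreover have "rc_cnj x \<noteq> 0"
    using False norm_rc_cnj[of x] by fastforce
  ultimately show ?thesis by simp
qed simp

lemma tendsto_rc_cnj:
  assumes "(f \<longlongrightarrow> (l::'k::real_or_complex)) F"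
  shows "((\<lambda>n. rc_cnj (f n)) \<longlongrightarrow> rc_cnj l) F"
proof -
  have "dist (rc_cnj x) (rc_cnj y) = dist x (y::'k)" for x y
    using norm_rc_cnj[of "x - y"] rc_cnj_add[of x "- y"]
    by (simp add: dist_norm rc_cnj_minus del: norm_rc_cnj)
  with assms show ?thesis by (simp add: tendsto_iff)
qed

section \<open>Inner product identities and continuity\<close>

context hilbert_space
begin

lemma ip_zero_left [simp]: "ip 0 y = 0"
  using ip_add[of 0 0 y] by simp

lemma ip_minus_left: "ip (- x) y = - ip x y"
  using ip_add[of x "- x" y] by (simp add: eq_neg_iff_add_eq_0 add.commute)

lemma ip_diff_left: "ip (x - y) z = ip x z - ip y z"
  using ip_add[of x "- y" z] by (simp add: ip_minus_left)

lemma ip_add_right: "ip x (y + z) = ip x y + ip x z"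
  by (metis ip_add ip_commute rc_cnj_add)

lemma ip_minus_right: "ip x (- y) = - ip x y"
  by (metis ip_minus_left ip_commute rc_cnj_minus)

lemma ip_diff_right: "ip x (y - z) = ip x y - ip x z"
  using ip_add_right[of x y "- z"] by (simp add: ip_minus_right)

lemma ip_zero_right [simp]: "ip x 0 = 0"
  using ip_add_right[of x 0 0] by simp

lemma ip_scale_right: "ip x (scale c y) = rc_cnj c * ip x y"
  by (metis ip_commute ip_scale rc_cnj_mult)

lemma ip_self_eq_0_iff [simp]: "ip x x = 0 \<longleftrightarrow> x = 0"
  by (simp add: ip_self)

lemma ip_eq_iff: "(\<forall>y. ip x y = ip z y) \<longleftrightarrow> x = z"
  by (metis ip_diff_left ip_self_eq_0_iff right_minus_eq)

text \<open>Pythagoras after removing from \<open>x\<close> its component along \<open>y\<close>. It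
  yields both Cauchy-Schwarz and the orthogonality of a closest point. For \<open>y = 0\<close> both
  quotients are 0 by convention.\<close>

lemma norm_minus_component_sq:
  "(norm (x - scale (ip x y / of_real ((norm y)\<^sup>2)) y))\<^sup>2 = (norm x)\<^sup>2 - (norm (ip x y))\<^sup>2 / (norm y)\<^sup>2"
proof (cases "y = 0")
  case False
  define N :: 'k where "N = of_real ((norm y)\<^sup>2)"
  define t where "t = ip x y / N"
  have N: "N \<noteq> 0" "rc_cnj N = N" "ip y y = N"
    using False by (auto simp: N_def ip_self simp del: of_real_power)
  have tN: "t * N = ip x y" by (simp add: t_def N)
  then have c: "rc_cnj (ip x y) = rc_cnj t * N" by (metis rc_cnj_mult N(2))
  have "ip (x - scale t y) (x - scale t y)
      = ip x x - rc_cnj t * ip x y - t * rc_cnj (ip x y) + t * rc_cnj t * N"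
    using ip_commute[of x y]
    by (simp add: ip_diff_left ip_diff_right ip_scale ip_scale_right N(3) algebra_simps)
  also have "\<dots> = ip x x - ip x y * rc_cnj (ip x y) / N"
    using N(1) c tN[symmetric] by (simp add: field_simps)
  also have "\<dots> = of_real ((norm x)\<^sup>2 - (norm (ip x y))\<^sup>2 / (norm y)\<^sup>2)"
    by (simp add: ip_self mult_rc_cnj scaleR_conv_of_real N_def)
  finally show ?thesis
    unfolding ip_self t_def N_def of_real_eq_iff .
qed simp

text \<open>Cauchy-Schwarz: the square on the left of \<open>norm_minus_component_sq\<close> is
  nonnegative.\<close>

lemma norm_ip_le: "norm (ip x y) \<le> norm x * norm y"
proof (cases "y = 0")
  case False
  have "(norm (ip x y))\<^sup>2 / (norm y)\<^sup>2 \<le> (norm x)\<^sup>2"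
    using norm_minus_component_sq[of x y]
    by (metis diff_ge_0_iff_ge zero_le_power2)
  then have "(norm (ip x y))\<^sup>2 \<le> (norm x * norm y)\<^sup>2"
    using False by (simp add: field_simps power_mult_distrib)
  then show ?thesis by (rule power2_le_imp_le) simp
qed simp

lemma parallelogram:
  fixes x y :: 'a
  shows "(norm (x + y))\<^sup>2 + (norm (x - y))\<^sup>2 = 2 * (norm x)\<^sup>2 + 2 * (norm y)\<^sup>2"
proof -
  have "ip (x + y) (x + y) + ip (x - y) (x - y) = 2 * ip x x + 2 * ip y y"
    by (simp add: ip_add ip_add_right ip_diff_left ip_diff_right)
  then have "of_real ((norm (x + y))\<^sup>2 + (norm (x - y))\<^sup>2)
      = (of_real (2 * (norm x)\<^sup>2 + 2 * (norm y)\<^sup>2) :: 'k)"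
    by (simp add: ip_self)
  then show ?thesis by (simp only: of_real_eq_iff)
qed

text \<open>Although sesquilinear over \<open>'k\<close>, the inner product is bilinear over the
  reals, since conjugation fixes real scalars, and bounded by Cauchy-Schwarz.\<close>

lemma tendsto_ip:
  assumes "(f \<longlongrightarrow> a) F" "(g \<longlongrightarrow> b) F"
  shows "((\<lambda>n. ip (f n) (g n)) \<longlongrightarrow> ip a b) F"
proof -
  have "bounded_bilinear ip"
  proof
    show "ip (scaleR r x) y = scaleR r (ip x y)" for r x y
      by (simp add: scaleR_conv_of_real ip_scale flip: scale_of_real)
    show "ip x (scaleR r y) = scaleR r (ip x y)" for r x y
      by (simp add: scaleR_conv_of_real ip_scale_right flip: scale_of_real)
    show "\<exists>K. \<forall>x y. norm (ip x y) \<le> norm x * norm y * K"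
      by (rule exI[of _ 1]) (simp add: norm_ip_le)
  qed (auto simp: ip_add ip_add_right)
  then show ?thesis using assms by (rule bounded_bilinear.tendsto)
qed

section \<open>Orthogonal projection onto a closed subspace\<close>

lemma subspace_midpoint:
  assumes "subspace M" "x \<in> M" "y \<in> M"
  shows "(1/2) *\<^sub>R (x + y) \<in> M"
proof -
  have "scale (of_real (1/2)) (x + y) \<in> M"
    using assms by (intro subspace_scale subspace_add)
  then show ?thesis by (simp only: scale_of_real)
qed

text \<open>The sets of near-minimisers of the distance are closed and nested, and the parallelogram
  law makes their diameters shrink to 0. Completeness then provides a common point.\<close>

lemma closest_point_in_subspace:
  assumes "closed M" "subspace M"
  obtains p where "p \<in> M" "\<And>m. m \<in> M \<Longrightarrow> norm (x - p) \<le> norm (x - m)"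
proof -
  define d where "d = infdist x M"
  have ne: "M \<noteq> {}" using subspace_0[OF assms(2)] by auto
  have d0: "0 \<le> d" by (simp add: d_def infdist_nonneg)
  have le_d: "d\<^sup>2 \<le> (norm (x - m))\<^sup>2" if "m \<in> M" for m
    using infdist_le[OF that, of x] d0 by (simp add: d_def dist_norm power_mono)
  define S where "S n = {m\<in>M. (norm (x - m))\<^sup>2 \<le> d\<^sup>2 + inverse (Suc n)}" for n
  have "\<exists>p. \<Inter>(range S) = {p}"
  proof (rule decreasing_closed_nest_sing)
    show "closed (S n)" for n
    proof -
      have "closed {m. (norm (x - m))\<^sup>2 \<le> d\<^sup>2 + inverse (Suc n)}"
        by (intro closed_Collect_le continuous_intros)
      then show ?thesis using assms(1) by (auto simp: S_def Collect_conj_eq)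
    qed
    show "S n \<noteq> {}" for n
    proof -
      \<comment> \<open>The infimum need not be attained yet, so nonemptiness of \<open>S n\<close>
        rests on the strictly positive slack.\<close>
      have "infdist x M < sqrt (d\<^sup>2 + inverse (Suc n))"
        unfolding d_def[symmetric] by (rule real_less_rsqrt) simp
      then obtain m where m: "m \<in> M" "dist x m < sqrt (d\<^sup>2 + inverse (Suc n))"
        using ne by (metis infdist_notempty cINF_less_iff bdd_below_image_dist)
      have "(norm (x - m))\<^sup>2 \<le> (sqrt (d\<^sup>2 + inverse (Suc n)))\<^sup>2"
        using m(2) by (intro power_mono) (auto simp: dist_norm)
      with m(1) show ?thesis by (auto simp: S_def)
    qed
    show "S n \<subseteq> S m" if "m \<le> n" for m n
    proof -
      have "inverse (real (Suc n)) \<le> inverse (real (Suc m))"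
        using that by (intro le_imp_inverse_le) auto
      then have "d\<^sup>2 + inverse (real (Suc n)) \<le> d\<^sup>2 + inverse (real (Suc m))"
        by (rule add_left_mono)
      then show ?thesis unfolding S_def by (blast intro: order_trans)
    qed
    show "\<exists>n. \<forall>a\<in>S n. \<forall>b\<in>S n. dist a b < e" if e: "e > 0" for e
    proof -
      obtain n where n: "inverse (real (Suc n)) < e\<^sup>2 / 4"
        using reals_Archimedean[of "e\<^sup>2 / 4"] e by auto
      have "dist a b < e" if ab: "a \<in> S n" "b \<in> S n" for a b
      proof -
        \<comment> \<open>The midpoint of \<open>a\<close> and \<open>b\<close> is in
          \<open>M\<close>, hence at distance at least \<open>d\<close> from \<open>x\<close>. In
          the parallelogram law for \<open>x - a\<close> and \<open>x - b\<close> the terms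
          \<open>4 * d^2\<close> cancel, leaving four times the slack.\<close>
        have "d\<^sup>2 \<le> (norm (x - (1/2) *\<^sub>R (a + b)))\<^sup>2"
          using ab by (intro le_d subspace_midpoint[OF assms(2)]) (auto simp: S_def)
        moreover have "(x - a) + (x - b) = 2 *\<^sub>R (x - (1/2) *\<^sub>R (a + b))"
          by (simp add: algebra_simps scaleR_2)
        then have "(norm ((x - a) + (x - b)))\<^sup>2 = 4 * (norm (x - (1/2) *\<^sub>R (a + b)))\<^sup>2"
          by (simp add: power_mult_distrib)
        moreover have "(norm ((x - a) - (x - b)))\<^sup>2 = (norm (a - b))\<^sup>2"
          by (simp add: norm_minus_commute)
        ultimately have "(norm (a - b))\<^sup>2 \<le> 4 * inverse (real (Suc n))"
          using parallelogram[of "x - a" "x - b"] ab by (simp add: S_def)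
        then have "(norm (a - b))\<^sup>2 < e\<^sup>2" using n by linarith
        then show ?thesis using e by (simp add: dist_norm power_less_imp_less_base)
      qed
      then show ?thesis by blast
    qed
  qed
  then obtain p where p: "\<And>n. p \<in> S n" by blast
  have "(norm (x - p))\<^sup>2 \<le> d\<^sup>2 + e" if e: "e > 0" for e
  proof -
    obtain n where "inverse (real (Suc n)) < e" using reals_Archimedean[OF e] by blast
    moreover have "(norm (x - p))\<^sup>2 \<le> d\<^sup>2 + inverse (real (Suc n))"
      using p[of n] by (simp only: S_def mem_Collect_eq)
    ultimately show ?thesis by linarith
  qed
  then have "(norm (x - p))\<^sup>2 \<le> d\<^sup>2" by (rule field_le_epsilon)
  then have "norm (x - p) \<le> norm (x - m)" if "m \<in> M" for m
    using le_d[OF that] by (meson order_trans power2_le_imp_le norm_ge_zero)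
  with p that show thesis by (auto simp: S_def)
qed

text \<open>Moving the closest point \<open>p\<close> along \<open>m\<close> with the optimal
  coefficient \<open>t\<close> lowers the squared distance by
  \<open>norm (ip (x - p) m)^2 / norm m^2\<close>, so minimality forces this to be 0.
  \<open>P\<close> is chosen pointwise; further properties are derived from the two stated
  here.\<close>

lemma orthogonal_projection:
  assumes "closed M" "subspace M"
  obtains P where "\<And>x. P x \<in> M" "\<And>x m. m \<in> M \<Longrightarrow> ip (x - P x) m = 0"
proof -
  have "\<exists>p. p \<in> M \<and> (\<forall>m\<in>M. ip (x - p) m = 0)" for x
  proof -
    obtain p where p: "p \<in> M" "\<And>m. m \<in> M \<Longrightarrow> norm (x - p) \<le> norm (x - m)"
      using closest_point_in_subspace[OF assms, where x=x] by blast
    have "ip (x - p) m = 0" if m: "m \<in> M" for m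
    proof (cases "m = 0")
      case False
      define t where "t = ip (x - p) m / of_real ((norm m)\<^sup>2)"
      have "norm (x - p) \<le> norm (x - (p + scale t m))"
        using p(1) m assms(2) by (intro p(2) subspace_add subspace_scale)
      then have "(norm (x - p))\<^sup>2 \<le> (norm (x - p - scale t m))\<^sup>2"
        by (intro power_mono) (auto simp: algebra_simps)
      with norm_minus_component_sq[of "x - p" m] have "(norm (ip (x - p) m))\<^sup>2 / (norm m)\<^sup>2 \<le> 0"
        by (simp add: t_def)
      with False show ?thesis by (simp add: divide_le_0_iff)
    qed simp
    with p(1) show ?thesis by blast
  qed
  with that show thesis by metis
qed

section \<open>Weak and strong convergence\<close>

text \<open>Uniform boundedness by Baire category: the closed sets \<open>F k\<close> on which all
  functionals \<open>ip (u n)\<close> are bounded by \<open>k\<close> cover the space, so one of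
  them contains a ball.\<close>

lemma weakly_convergent_imp_bounded:
  assumes conv: "\<And>y. (\<lambda>n. ip (u n) y) \<longlonglongrightarrow> ip l y"
  obtains B where "\<And>n::nat. norm (u n) \<le> B"
proof -
  define F where "F k = {y. \<forall>n. norm (ip (u n) y) \<le> real k}" for k :: nat
  have closed: "closed (F k)" for k
  proof -
    have "continuous_on UNIV (\<lambda>y. ip (u n) y)" for n
      by (auto simp: continuous_on_def intro!: tendsto_ip tendsto_intros)
    then have "closed {y. norm (ip (u n) y) \<le> real k}" for n
      by (intro closed_Collect_le continuous_intros) auto
    then show ?thesis by (simp add: F_def Collect_all_eq closed_INT)
  qed
  have cover: "\<Union>(range F) = UNIV"
  proof -
    have "\<exists>k. y \<in> F k" for y
    proof -
      have "Bseq (\<lambda>n. ip (u n) y)" using conv convergentI convergent_imp_Bseq by blast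
      then obtain K where "\<And>n. norm (ip (u n) y) \<le> K" by (auto simp: Bseq_def)
      moreover obtain k :: nat where "K \<le> real k" using real_arch_simple by blast
      ultimately have "y \<in> F k" unfolding F_def by (blast intro: order_trans)
      then show ?thesis ..
    qed
    then show ?thesis by auto
  qed
  have "\<exists>k. interior (F k) \<noteq> {}"
  proof (rule ccontr)
    assume "\<not> ?thesis"
    then have "Met_TC.mtopology interior_of \<Union>(range F) = {}"
      using closed by (intro Met_TC.metric_Baire_category_alt) auto
    then show False using cover by simp
  qed
  then obtain k y0 r where r: "r > 0" "ball y0 r \<subseteq> F k"
    by (metis all_not_in_conv mem_interior)
  have "norm (u n) \<le> 4 * real k / r" for n
  proof (cases "u n = 0")
    case False
    \<comment> \<open>The multiple \<open>z\<close> of \<open>u n\<close> has norm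
      \<open>r / 2\<close>, so \<open>y0 + z\<close> stays in the ball. Pairing \<open>u n\<close>
      with \<open>z\<close> gives \<open>r / 2 * norm (u n)\<close>, which is at most
      \<open>2 * k\<close>.\<close>
    define c where "c = r / (2 * norm (u n))"
    define z where "z = c *\<^sub>R u n"
    have nz: "norm z = r / 2" using False r by (simp add: z_def c_def)
    have "y0 + z \<in> F k" "y0 \<in> F k"
      using r nz by (auto simp: dist_norm)
    then have "norm (ip (u n) (y0 + z) - ip (u n) y0) \<le> real k + real k"
      by (intro order_trans[OF norm_triangle_ineq4] add_mono) (auto simp: F_def)
    moreover have "ip (u n) (y0 + z) - ip (u n) y0 = of_real (c * (norm (u n))\<^sup>2)"
      by (simp add: z_def ip_add_right ip_scale_right ip_self flip: scale_of_real)
    moreover have "c * (norm (u n))\<^sup>2 = r / 2 * norm (u n)"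
      using False by (simp add: c_def power2_eq_square)
    ultimately have "\<bar>r / 2 * norm (u n)\<bar> \<le> real k + real k" by (simp only: norm_of_real)
    then show ?thesis using r by (simp add: field_simps)
  qed (use r in simp)
  with that show thesis .
qed

text \<open>Split \<open>u n\<close> as \<open>(u n - a) + a\<close>: the first part contributes 0
  in the limit because \<open>v\<close> is bounded, the second converges by weak
  convergence.\<close>

lemma tendsto_ip_strong_weak:
  assumes u: "u \<longlonglongrightarrow> a" and v: "\<And>y. (\<lambda>n. ip (v n) y) \<longlonglongrightarrow> ip b y"
  shows "(\<lambda>n. ip (v n) (u n)) \<longlonglongrightarrow> ip b a"
proof -
  obtain B where B: "\<And>n. norm (v n) \<le> B"
    using weakly_convergent_imp_bounded[OF v] by blast
  have "(\<lambda>n. ip (v n) (u n - a)) \<longlonglongrightarrow> 0"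
  proof (rule Lim_null_comparison)
    show "\<forall>\<^sub>F n in sequentially. norm (ip (v n) (u n - a)) \<le> B * norm (u n - a)"
      using norm_ip_le B by (intro always_eventually allI) (meson mult_right_mono norm_ge_zero order_trans)
    show "(\<lambda>n. B * norm (u n - a)) \<longlonglongrightarrow> 0"
      using u by (intro tendsto_mult_right_zero tendsto_norm_zero LIM_zero)
  qed
  from tendsto_add[OF this v[of a]] show ?thesis
    by (simp add: ip_diff_right)
qed

text \<open>A subsequence staying away from \<open>l\<close> would have a strongly convergent
  further subsequence, whose limit must agree with the weak limit \<open>l\<close>.\<close>

lemma weakly_convergent_relcompact_imp_tendsto:
  assumes w: "\<And>y. (\<lambda>n. ip (w n) y) \<longlonglongrightarrow> ip l y" and K: "compact (closure (range w))"
  shows "w \<longlonglongrightarrow> l"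
proof (rule ccontr)
  assume "\<not> ?thesis"
  then obtain e where e: "e > 0" "\<exists>\<^sub>F n in sequentially. e \<le> dist (w n) l"
    by (auto simp: tendsto_iff frequently_def not_le)
  then have "infinite {n. e \<le> dist (w n) l}"
    by (simp add: frequently_cofinite flip: cofinite_eq_sequentially)
  then obtain r :: "nat \<Rightarrow> nat" where r: "strict_mono r" "\<And>n. e \<le> dist (w (r n)) l"
    using infinite_enumerate by blast
  have "\<forall>n. (w \<circ> r) n \<in> closure (range w)"
    using closure_subset by fastforce
  with K obtain m s where s: "strict_mono s" "(w \<circ> r \<circ> s) \<longlonglongrightarrow> m"
    unfolding compact_def by meson
  have "ip m y = ip l y" for y
  proof (rule LIMSEQ_unique)
    show "(\<lambda>n. ip ((w \<circ> r \<circ> s) n) y) \<longlonglongrightarrow> ip m y"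
      using s(2) by (intro tendsto_ip tendsto_const)
    show "(\<lambda>n. ip ((w \<circ> r \<circ> s) n) y) \<longlonglongrightarrow> ip l y"
      using LIMSEQ_subseq_LIMSEQ[OF w strict_mono_o[OF r(1) s(1)]] by (simp add: o_def)
  qed
  then have "m = l" using ip_eq_iff by blast
  then have "\<forall>\<^sub>F n in sequentially. dist ((w \<circ> r \<circ> s) n) l < e"
    using s(2) e(1) tendstoD by blast
  then show False
    using r(2) by (auto simp: eventually_sequentially not_less[symmetric])
qed

end

section \<open>Adjoints, graph norms and kernels\<close>

text \<open>Turns the \<open>THE\<close> into a rule for computing adjoints. The difference of two
  candidates is orthogonal to the dense domain; approximating it from there shows that it is
  orthogonal to itself.\<close>

lemma adjoint_op_unique:
  assumes H: "hilbert_space s ip" and d: "densely_defined A"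
    and z: "\<forall>x\<in>dom A. ip' (the (A x)) y = ip x z"
  shows "adjoint_op ip ip' A y = Some z"
proof -
  interpret hilbert_space s ip by fact
  have "z' = z" if z': "\<forall>x\<in>dom A. ip' (the (A x)) y = ip x z'" for z'
  proof -
    have "z' - z \<in> closure (dom A)" using d by (simp add: densely_defined_def)
    then obtain x where x: "\<And>n. x n \<in> dom A" "x \<longlonglongrightarrow> z' - z"
      unfolding closure_sequential by blast
    have "ip (x n) (z' - z) = 0" for n
      using z z' x(1) by (metis ip_diff_right right_minus_eq)
    then have "(\<lambda>n. 0) \<longlonglongrightarrow> ip (z' - z) (z' - z)"
      using tendsto_ip[OF x(2) tendsto_const, of "z' - z"] by simp
    then have "ip (z' - z) (z' - z) = 0" by (simp add: LIMSEQ_const_iff)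
    then show ?thesis by simp
  qed
  with z have "(THE z. \<forall>x\<in>dom A. ip' (the (A x)) y = ip x z) = z"
    by (intro the_equality) auto
  with z show ?thesis by (auto simp: adjoint_op_def)
qed

lemma adjoint_op_ip:
  assumes "hilbert_space s ip" and "densely_defined A"
    and "y \<in> dom (adjoint_op ip ip' A)" and "x \<in> dom A"
  shows "ip' (the (A x)) y = ip x (the (adjoint_op ip ip' A y))"
proof -
  obtain z where "\<forall>x\<in>dom A. ip' (the (A x)) y = ip x z"
    using assms(3) unfolding adjoint_op_def dom_def by (auto split: if_splits)
  with adjoint_op_unique[where A=A and ip=ip and ip'=ip', OF assms(1,2) this] assms(4)
  show ?thesis by simp
qed

text \<open>Sums and multiples of adjoint values satisfy the defining identity, so uniqueness
  identifies them. This makes \<open>weakly_converges_in_domD\<close> applicable to the adjoint of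
  \<open>A0\<close>.\<close>

lemma linear_operator_adjoint_op:
  assumes H: "hilbert_space s ip" and H': "hilbert_space s' ip'" and d: "densely_defined A"
  shows "linear_operator s' s (adjoint_op ip ip' A)"
proof -
  interpret H: hilbert_space s ip by fact
  interpret H': hilbert_space s' ip' by fact
  let ?A = "adjoint_op ip ip' A"
  note uniq = adjoint_op_unique[where ip'=ip', OF H d]
  note adj = adjoint_op_ip[where ip'=ip', OF H d]
  have 0: "?A 0 = Some 0" by (rule uniq) simp
  have add: "?A (x + y) = Some (the (?A x) + the (?A y))" if "x \<in> dom ?A" "y \<in> dom ?A" for x y
    using that by (intro uniq ballI) (simp add: H.ip_add_right H'.ip_add_right adj)
  have scale: "?A (s' c x) = Some (s c (the (?A x)))" if "x \<in> dom ?A" for c x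
    using that by (intro uniq ballI) (simp add: H.ip_scale_right H'.ip_scale_right adj)
  show ?thesis
    unfolding linear_operator_def H'.subspace_def using 0 add scale by (auto simp: domI)
qed

text \<open>Weak convergence in the graph sense splits into weak convergence of the vectors and of
  their images: by Cauchy-Schwarz, pairing either with a fixed vector is bounded in the graph
  norm.\<close>

lemma weakly_converges_in_domD:
  assumes H: "hilbert_space s ip" and H': "hilbert_space s' ip'" and A: "linear_operator s s' A"
    and w: "weakly_converges_in_dom s ip ip' A u l"
  shows "(\<lambda>n. ip (u n) y) \<longlonglongrightarrow> ip l y"
    and "(\<lambda>n. ip' (the (A (u n))) z) \<longlonglongrightarrow> ip' (the (A l)) z"
proof -
  interpret H: hilbert_space s ip by fact
  interpret H': hilbert_space s' ip' by fact
  have graph: "sqrt (norm (graph_ip ip ip' A x x)) = sqrt ((norm x)\<^sup>2 + (norm (the (A x)))\<^sup>2)" for x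
  proof -
    have "graph_ip ip ip' A x x = of_real ((norm x)\<^sup>2 + (norm (the (A x)))\<^sup>2)"
      by (simp add: graph_ip_def H.ip_self H'.ip_self)
    then show ?thesis by (simp only: norm_of_real) simp
  qed
  have "bounded_functional_on s (dom A) (graph_ip ip ip' A) (\<lambda>x. ip x y)"
    unfolding bounded_functional_on_def graph
  proof (intro conjI exI ballI)
    show "norm (ip x y) \<le> norm y * sqrt ((norm x)\<^sup>2 + (norm (the (A x)))\<^sup>2)" for x
    proof -
      have "norm x * norm y \<le> sqrt ((norm x)\<^sup>2 + (norm (the (A x)))\<^sup>2) * norm y"
        by (intro mult_right_mono real_sqrt_sum_squares_ge1) simp
      from order_trans[OF H.norm_ip_le this] show ?thesis by (simp add: mult.commute)
    qed
  qed (auto simp: H.ip_add H.ip_scale)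
  with w show "(\<lambda>n. ip (u n) y) \<longlonglongrightarrow> ip l y"
    unfolding weakly_converges_in_dom_def weakly_converges_on_def by blast
  have "bounded_functional_on s (dom A) (graph_ip ip ip' A) (\<lambda>x. ip' (the (A x)) z)"
    unfolding bounded_functional_on_def graph
  proof (intro conjI exI ballI)
    show "norm (ip' (the (A x)) z) \<le> norm z * sqrt ((norm x)\<^sup>2 + (norm (the (A x)))\<^sup>2)" for x
    proof -
      have "norm (the (A x)) * norm z \<le> sqrt ((norm x)\<^sup>2 + (norm (the (A x)))\<^sup>2) * norm z"
        by (intro mult_right_mono real_sqrt_sum_squares_ge2) simp
      from order_trans[OF H'.norm_ip_le this] show ?thesis by (simp add: mult.commute)
    qed
  qed (use A in \<open>auto simp: linear_operator_def H'.ip_add H'.ip_scale\<close>)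
  with w show "(\<lambda>n. ip' (the (A (u n))) z) \<longlonglongrightarrow> ip' (the (A l)) z"
    unfolding weakly_converges_in_dom_def weakly_converges_on_def by blast
qed

lemma closed_ker:
  assumes "closed_operator A"
  shows "closed (ker A)"
proof -
  have "ker A = (\<lambda>x. (x, 0)) -` Map.graph A"
    by (auto simp: ker_def Map.graph_def)
  with assms show ?thesis
    by (simp add: closed_operator_def closed_vimage continuous_intros)
qed

lemma subspace_ker:
  assumes "hilbert_space s ip" "hilbert_space s' ip'" "linear_operator s s' A"
  shows "module.subspace s (ker A)"
proof -
  interpret H: hilbert_space s ip by fact
  interpret H': hilbert_space s' ip' by fact
  have ker: "x \<in> ker A \<longleftrightarrow> x \<in> dom A \<and> the (A x) = 0" for x
    by (auto simp: ker_def)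
  have sub: "H.subspace (dom A)" using assms(3) by (simp add: linear_operator_def)
  have "0 \<in> ker A"
    using assms(3) H.subspace_0[OF sub] H.scale_zero_left[of 0] H'.scale_zero_left
    unfolding linear_operator_def ker by metis
  with assms(3) H.subspace_add[OF sub] H.subspace_scale[OF sub] show ?thesis
    by (auto simp: H.subspace_def ker linear_operator_def)
qed

theorem theorem2p5:
  fixes scale0 :: "'k::real_or_complex \<Rightarrow> 'a::banach \<Rightarrow> 'a" and ip0 :: "'a \<Rightarrow> 'a \<Rightarrow> 'k"
    and scale1 :: "'k \<Rightarrow> 'b::banach \<Rightarrow> 'b" and ip1 :: "'b \<Rightarrow> 'b \<Rightarrow> 'k"
    and scale2 :: "'k \<Rightarrow> 'c::banach \<Rightarrow> 'c" and ip2 :: "'c \<Rightarrow> 'c \<Rightarrow> 'k"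
    and A0 :: "'a \<rightharpoonup> 'b" and A1 :: "'b \<rightharpoonup> 'c"
    and u v :: "nat \<Rightarrow> 'b" and u_lim v_lim :: 'b
  assumes "hilbert_space scale0 ip0" and "hilbert_space scale1 ip1" and "hilbert_space scale2 ip2"
    and "linear_operator scale0 scale1 A0" and "densely_defined A0" and "closed_operator A0"
    and "linear_operator scale1 scale2 A1" and "densely_defined A1" and "closed_operator A1"
    and "compact_sequence ip0 ip1 A0 A1"
    and "weakly_converges_in_dom scale1 ip1 ip0 (adjoint_op ip0 ip1 A0) u u_lim"
    and "weakly_converges_in_dom scale1 ip1 ip2 A1 v v_lim"
  shows "(\<lambda>n. ip1 (u n) (v n)) \<longlonglongrightarrow> ip1 u_lim v_lim"
proof -
  interpret H0: hilbert_space scale0 ip0 by fact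
  interpret H1: hilbert_space scale1 ip1 by fact
  interpret H2: hilbert_space scale2 ip2 by fact
  let ?A = "adjoint_op ip0 ip1 A0"
  have lin: "linear_operator scale1 scale0 ?A"
    using assms(1,2,5) by (rule linear_operator_adjoint_op)
  note adj_unique = adjoint_op_unique[where ip'=ip1, OF assms(1,5)]
  note adj = adjoint_op_ip[where ip'=ip1, OF assms(1,5)]
  have u: "u n \<in> dom ?A" and v: "v n \<in> dom A1" for n
    using assms(11,12) by (auto simp: weakly_converges_in_dom_def weakly_converges_on_def)
  note u_weak = weakly_converges_in_domD[OF assms(2,1) lin assms(11)]
  note v_weak = weakly_converges_in_domD[OF assms(2,3,7,12)]
  obtain Bu where Bu: "\<And>n. norm (u n) \<le> Bu"
    using H1.weakly_convergent_imp_bounded[OF u_weak(1)] by blast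
  obtain Bv where Bv: "\<And>n. norm (v n) \<le> Bv"
    using H1.weakly_convergent_imp_bounded[OF v_weak(1)] by blast
  obtain BAu where BAu: "\<And>n. norm (the (?A (u n))) \<le> BAu"
    using H0.weakly_convergent_imp_bounded[OF u_weak(2)] by blast
  obtain BAv where BAv: "\<And>n. norm (the (A1 (v n))) \<le> BAv"
    using H2.weakly_convergent_imp_bounded[OF v_weak(2)] by blast

  have sub: "H1.subspace (ker A1)" using assms(2,3,7) by (rule subspace_ker)
  obtain P where P: "\<And>x. P x \<in> ker A1" "\<And>x m. m \<in> ker A1 \<Longrightarrow> ip1 (x - P x) m = 0"
    using H1.orthogonal_projection[OF closed_ker[OF assms(9)] sub] by metis
  define Q where "Q x = x - P x" for x
  have Q_orth: "ip1 m (Q x) = 0" if "m \<in> ker A1" for m x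
    using P(2)[OF that, of x] H1.ip_commute[of m "Q x"] by (simp add: Q_def)
  \<comment> \<open>Both sides equal \<open>ip1 (P x) (P y)\<close>.\<close>
  have P_sym: "ip1 (P x) y = ip1 x (P y)" for x y
    using P(2)[OF P(1), of x y] Q_orth[OF P(1), of x y]
    by (simp add: Q_def H1.ip_diff_left H1.ip_diff_right)
  have Q_sym: "ip1 (Q x) y = ip1 x (Q y)" for x y
    by (simp add: Q_def H1.ip_diff_left H1.ip_diff_right P_sym)
  \<comment> \<open>Pythagoras for the orthogonal decomposition
    \<open>x = P x + Q x\<close>.\<close>
  have norm_le: "norm (P x) \<le> norm x" "norm (Q x) \<le> norm x" for x
  proof -
    have "of_real ((norm x)\<^sup>2) = (of_real ((norm (P x))\<^sup>2 + (norm (Q x))\<^sup>2) :: 'k)"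
      using Q_orth[OF P(1), of x x] P(2)[OF P(1), of x x]
      unfolding of_real_add H1.ip_self[symmetric]
      by (simp add: Q_def H1.ip_diff_left H1.ip_diff_right)
    then have "(norm x)\<^sup>2 = (norm (P x))\<^sup>2 + (norm (Q x))\<^sup>2" by (simp only: of_real_eq_iff)
    then show "norm (P x) \<le> norm x" "norm (Q x) \<le> norm x"
      by (simp_all add: power2_le_imp_le)
  qed
  have ran: "the (A0 x) \<in> ker A1" if "x \<in> dom A0" for x
    using assms(10) that unfolding compact_sequence_def operator_sequence_def
    by (metis domD option.sel ranI subsetD)

  \<comment> \<open>\<open>Q x\<close> is orthogonal to \<open>ker A1\<close>, hence to the range of
    \<open>A0\<close>, so 0 satisfies the identity defining the adjoint. This places every
    \<open>Q x\<close> in \<open>dom ?A\<close>.\<close>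
  have A_Q: "?A (Q x) = Some 0" for x
    by (rule adj_unique) (simp add: Q_orth ran)
  \<comment> \<open>\<open>P x\<close> and \<open>x\<close> differ by \<open>Q x\<close>, so they
    pair identically with the range of \<open>A0\<close>.\<close>
  have A_P: "?A (P x) = Some (the (?A x))" if "x \<in> dom ?A" for x
  proof (rule adj_unique, intro ballI)
    fix y assume y: "y \<in> dom A0"
    have "ip1 (the (A0 y)) (P x) = ip1 (the (A0 y)) x"
      using Q_orth[OF ran[OF y], of x] by (simp add: Q_def H1.ip_diff_right)
    then show "ip1 (the (A0 y)) (P x) = ip0 y (the (?A x))"
      using adj[OF that y] by simp
  qed
  have A1_P: "A1 (P x) = Some 0" for x using P(1) by (simp add: ker_def)
  have A1_Q: "A1 (Q x) = Some (the (A1 x))" if x: "x \<in> dom A1" for x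
  proof -
    have dP: "P x \<in> dom A1" using A1_P by blast
    have "Q x \<in> dom A1"
      unfolding Q_def using assms(7) x dP H1.subspace_diff by (auto simp: linear_operator_def)
    moreover have "the (A1 (Q x + P x)) = the (A1 (Q x)) + the (A1 (P x))"
      using assms(7) calculation dP by (auto simp: linear_operator_def)
    ultimately show ?thesis using A1_P by (auto simp: Q_def)
  qed

  have compact: "compact (closure (range w))"
    if "\<And>n. w n \<in> dom A1" "\<And>n. w n \<in> dom ?A" "\<And>n. norm (w n) \<le> B"
      "\<And>n. norm (the (A1 (w n))) \<le> B1" "\<And>n. norm (the (?A (w n))) \<le> B0"
    for w :: "nat \<Rightarrow> 'b" and B B1 B0
  proof -
    have "\<forall>x\<in>range w. sqrt ((norm x)\<^sup>2 + (norm (the (A1 x)))\<^sup>2 + (norm (the (?A x)))\<^sup>2)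
        \<le> sqrt (B\<^sup>2 + B1\<^sup>2 + B0\<^sup>2)"
      using that by (auto intro!: real_sqrt_le_mono add_mono power_mono)
    moreover have "range w \<subseteq> dom A1 \<inter> dom ?A" using that by auto
    ultimately show ?thesis using assms(10) unfolding compact_sequence_def by meson
  qed

  \<comment> \<open>Symmetry moves \<open>P\<close> onto the test vector, which gives weak
    convergence. For relative compactness, \<open>A1\<close> vanishes on \<open>P (u n)\<close>,
    hence the bound 0, and the adjoint has the same values there as on \<open>u n\<close>.\<close>
  have Pu: "(\<lambda>n. P (u n)) \<longlonglongrightarrow> P u_lim"
  proof (rule H1.weakly_convergent_relcompact_imp_tendsto)
    show "(\<lambda>n. ip1 (P (u n)) y) \<longlonglongrightarrow> ip1 (P u_lim) y" for y
      using u_weak(1)[of "P y"] by (simp add: P_sym)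
    show "compact (closure (range (\<lambda>n. P (u n))))"
      using u BAu order_trans[OF norm_le(1) Bu]
      by (intro compact[where B=Bu and ?B1.0=0 and ?B0.0=BAu]) (auto simp: A_P A1_P)
  qed
  have Qv: "(\<lambda>n. Q (v n)) \<longlonglongrightarrow> Q v_lim"
  proof (rule H1.weakly_convergent_relcompact_imp_tendsto)
    show "(\<lambda>n. ip1 (Q (v n)) y) \<longlonglongrightarrow> ip1 (Q v_lim) y" for y
      using v_weak(1)[of "Q y"] by (simp add: Q_sym)
    show "compact (closure (range (\<lambda>n. Q (v n))))"
      using v BAv order_trans[OF norm_le(2) Bv]
      by (intro compact[where B=Bv and ?B1.0=BAv and ?B0.0=0]) (auto simp: A_Q A1_Q)
  qed
  \<comment> \<open>\<open>tendsto_ip_strong_weak\<close> expects the strongly convergent factor in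
    the second slot. In \<open>ip1 (P (u n)) (v n)\<close> it is in the first, so this summand is
    written as a conjugate.\<close>
  have "(\<lambda>n. rc_cnj (ip1 (v n) (P (u n))) + ip1 (u n) (Q (v n)))
      \<longlonglongrightarrow> rc_cnj (ip1 v_lim (P u_lim)) + ip1 u_lim (Q v_lim)"
    by (intro tendsto_add tendsto_rc_cnj H1.tendsto_ip_strong_weak[OF Pu v_weak(1)]
        H1.tendsto_ip_strong_weak[OF Qv u_weak(1)])
  moreover have "rc_cnj (ip1 y (P x)) + ip1 x (Q y) = ip1 x y" for x y
    using H1.ip_commute[of "P x" y] P_sym[of x y] by (simp add: Q_def H1.ip_diff_right)
  ultimately show ?thesis by simp
qed

end
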